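(* Let $w\in S_n$, and let $I\subseteq\mathrm{Asc}_L(w)$, $J\subseteq\mathrm{Asc}_R(w)$. Then $W_IwW_J$ is a lex-minimal presentation of a parabolic double coset of $S_n$ if and only if both of the following hold: (1) whenever $1\le a\le b\le n-1$ are such that $\{a-1,a,\dots,b,b+1\}\cap I=\{a,\dots,b\}$ and $a,\dots,b$ are all small left ascents of $w$, then $\{w^{-1}(a),\dots,w^{-1}(b)\}\not\subseteq J$ and $\{w^{-1}(a)-1,w^{-1}(a),\dots,w^{-1}(b),w^{-1}(b)+1\}\cap J\neq\emptyset$; (2) whenever $1\le a\le b\le n-1$ are such that $\{a-1,a,\dots,b,b+1\}\cap J=\{a,\dots,b\}$ and $a,\dots,b$ are all small right ascents of $w$, then $\{w(a),\dots,w(b)\}\not\subseteq I$.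
   Context: $S_n$ is the symmetric group generated by $s_i=(i\leftrightarrow i+1)$, $1\le i\le n-1$; subsets of $\{1,\dots,n-1\}$ are identified with subsets of $\{s_1,\dots,s_{n-1}\}$, and $W_I$ is the subgroup generated by $\{s_i:i\in I\}$. Permutations are in one-line notation. $\mathrm{Asc}_R(w)=\{j: w(j)<w(j+1)\}$, and $j$ is a small right ascent if $w(j+1)=w(j)+1$; $\mathrm{Asc}_L(w)=\{i: w^{-1}(i)<w^{-1}(i+1)\}$, and $i$ is a small left ascent if $w^{-1}(i+1)=w^{-1}(i)+1$. A presentation of a parabolic double coset $C$ is a triple $(I,x,J)$ with $C=W_IxW_J$; it is lex-minimal if $x$ is the (Bruhat-)minimal element of $C$ and $(|I|,|J|)$ is lexicographically minimal among all presentations of $C$ (with any middle element). Indices $0$ and $n$ are never in $I$ or $J$. *)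

theory Defs
  imports "HOL-Algebra.Sym_Groups"
begin

text \<open>
  Permutations are functions on \<open>nat\<close> fixing everything outside \<open>{1..n}\<close>, multiplied as
  functions, \<open>(u v)(k) = u (v k)\<close>.  Thus right multiplication by \<open>simple_refl j\<close> exchanges the
  entries of the one-line notation in positions \<open>j, j + 1\<close>, and left multiplication by
  \<open>simple_refl i\<close> exchanges the values \<open>i, i + 1\<close>.  Sets of simple reflections of \<open>S\<^sub>n\<close> are
  given by their index sets, subsets of \<open>{1..<n}\<close>.
\<close>

definition simple_refl :: "nat \<Rightarrow> nat \<Rightarrow> nat" where
  "simple_refl i = transpose i (i + 1)"

definition parabolic :: "nat \<Rightarrow> nat set \<Rightarrow> (nat \<Rightarrow> nat) set" where
  "parabolic n I = generate (sym_group n) (simple_refl ` I)"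

definition double_coset :: "nat \<Rightarrow> nat set \<Rightarrow> (nat \<Rightarrow> nat) \<Rightarrow> nat set \<Rightarrow> (nat \<Rightarrow> nat) set" where
  "double_coset n I x J =
     (parabolic n I #>\<^bsub>sym_group n\<^esub> x) <#>\<^bsub>sym_group n\<^esub> parabolic n J"

definition coxeter_length :: "nat \<Rightarrow> (nat \<Rightarrow> nat) \<Rightarrow> nat" where
  "coxeter_length n w =
     (LEAST k. \<exists>is. length is = k \<and> set is \<subseteq> {1..<n} \<and> w = foldr (\<circ>) (map simple_refl is) id)"

text \<open>The reflections of \<open>S\<^sub>n\<close> (conjugates of simple reflections) are the transpositions.\<close>

definition bruhat_step :: "nat \<Rightarrow> (nat \<Rightarrow> nat) \<Rightarrow> (nat \<Rightarrow> nat) \<Rightarrow> bool" where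
  "bruhat_step n u v \<longleftrightarrow>
     u \<in> carrier (sym_group n) \<and>
     (\<exists>a b. 1 \<le> a \<and> a < b \<and> b \<le> n \<and> v = u \<otimes>\<^bsub>sym_group n\<^esub> transpose a b) \<and>
     coxeter_length n u < coxeter_length n v"

definition bruhat_le :: "nat \<Rightarrow> (nat \<Rightarrow> nat) \<Rightarrow> (nat \<Rightarrow> nat) \<Rightarrow> bool" where
  "bruhat_le n = (bruhat_step n)\<^sup>*\<^sup>*"

definition Asc_R :: "nat \<Rightarrow> (nat \<Rightarrow> nat) \<Rightarrow> nat set" where
  "Asc_R n w = {j \<in> {1..<n}. w j < w (j + 1)}"

definition Asc_L :: "nat \<Rightarrow> (nat \<Rightarrow> nat) \<Rightarrow> nat set" where
  "Asc_L n w = {i \<in> {1..<n}. inv' w i < inv' w (i + 1)}"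

definition small_Asc_R :: "nat \<Rightarrow> (nat \<Rightarrow> nat) \<Rightarrow> nat set" where
  "small_Asc_R n w = {j \<in> {1..<n}. w (j + 1) = w j + 1}"

definition small_Asc_L :: "nat \<Rightarrow> (nat \<Rightarrow> nat) \<Rightarrow> nat set" where
  "small_Asc_L n w = {i \<in> {1..<n}. inv' w (i + 1) = inv' w i + 1}"

definition is_presentation ::
    "nat \<Rightarrow> (nat \<Rightarrow> nat) set \<Rightarrow> nat set \<Rightarrow> (nat \<Rightarrow> nat) \<Rightarrow> nat set \<Rightarrow> bool" where
  "is_presentation n C I x J \<longleftrightarrow>
     I \<subseteq> {1..<n} \<and> J \<subseteq> {1..<n} \<and> x \<in> carrier (sym_group n) \<and> C = double_coset n I x J"

definition parabolic_double_coset :: "nat \<Rightarrow> (nat \<Rightarrow> nat) set \<Rightarrow> bool" where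
  "parabolic_double_coset n C \<longleftrightarrow> (\<exists>I x J. is_presentation n C I x J)"

definition bruhat_least :: "nat \<Rightarrow> (nat \<Rightarrow> nat) set \<Rightarrow> (nat \<Rightarrow> nat) \<Rightarrow> bool" where
  "bruhat_least n C x \<longleftrightarrow> x \<in> C \<and> (\<forall>y\<in>C. bruhat_le n x y)"

definition lex_minimal_presentation ::
    "nat \<Rightarrow> (nat \<Rightarrow> nat) set \<Rightarrow> nat set \<Rightarrow> (nat \<Rightarrow> nat) \<Rightarrow> nat set \<Rightarrow> bool" where
  "lex_minimal_presentation n C I x J \<longleftrightarrow>
     is_presentation n C I x J \<and> bruhat_least n C x \<and>
     (\<forall>I' x' J'. is_presentation n C I' x' J' \<longrightarrow>
        card I < card I' \<or> card I = card I' \<and> card J \<le> card J')"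

end

theory Submission
  imports Defs
begin

text \<open>
  If the generators \<open>A\<close> of a component of \<open>I\<close> are small left ascents, then
  \<open>s\<^sub>a w = w s\<^sub>p\<close> with \<open>p = w\<^sup>-\<^sup>1(a)\<close>, and a violation of (1) or (2) lets one delete
  \<open>A\<close> from \<open>I\<close>, moving it to \<open>J\<close> if need be, or delete a component of \<open>J\<close>.

  Conversely, let \<open>(I', w, J')\<close> present the same double coset, and let \<open>{l..m} \<subseteq> I\<close> contain some
  \<open>i \<notin> I'\<close>.  Left multiplication by the subgroup of \<open>I'\<close> preserves \<open>{..i}\<close>, so in every
  orbit of positions under the subgroup of \<open>J'\<close> each element of the coset has as many values
  \<open>\<le> i\<close> as \<open>w\<close> has.  Applied to the element obtained from \<open>w\<close> by exchanging the values \<open>l\<close> and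
  \<open>m + 1\<close>, this puts the positions of these two values into one such orbit; as \<open>w\<close> ascends there,
  \<open>l..m\<close> are small left ascents and their positions belong to \<open>J'\<close>.  Together with the
  analogous statements for the other sides, this turns (1) and (2) into \<open>I \<subseteq> I'\<close>, and into
  \<open>J \<subseteq> J'\<close> when \<open>I = I'\<close>.
\<close>

declare One_nat_def [simp del]

section \<open>Parabolic subgroups and double cosets\<close>

lemma simple_refl_eq [simp]:
  "simple_refl i i = i + 1" "simple_refl i (i + 1) = i"
  "k \<noteq> i \<Longrightarrow> k \<noteq> i + 1 \<Longrightarrow> simple_refl i k = k"
  by (auto simp: simple_refl_def transpose_def)

lemma simple_refl_involutory [simp]:
  "simple_refl i \<circ> simple_refl i = id" "simple_refl i (simple_refl i k) = k"
  by (auto simp: simple_refl_def)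

lemma inv_simple_refl [simp]: "inv' (simple_refl i) = simple_refl i"
  by (simp add: simple_refl_def)

lemma simple_refl_permutes: "i \<in> {1..<n} \<Longrightarrow> simple_refl i permutes {1..n}"
  unfolding simple_refl_def by (rule permutes_swap_id) auto

lemma simple_refl_commute:
  assumes "k \<noteq> i + 1" "i \<noteq> k + 1"
  shows "simple_refl i \<circ> simple_refl k = simple_refl k \<circ> simple_refl i"
proof (cases "i = k")
  case False
  then have "transpose i (i + 1) k = k" "transpose i (i + 1) (k + 1) = k + 1"
    using assms by (auto simp: transpose_def)
  then show ?thesis
    using transpose_comp_eq[of "simple_refl i" k "k + 1"]
    by (simp add: simple_refl_def)
qed simp

lemma parabolic_permutes:
  assumes "u \<in> parabolic n I" "I \<subseteq> {1..<n}"
  shows "u permutes {1..n}"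
proof -
  have "simple_refl ` I \<subseteq> carrier (sym_group n)"
    using assms(2) by (auto simp: sym_group_carrier simple_refl_permutes subset_iff)
  then show ?thesis
    using group.generate_incl[OF sym_group_is_group] assms(1)
    unfolding parabolic_def by (metis subsetD sym_group_carrier)
qed

lemma id_in_parabolic [simp]: "id \<in> parabolic n I"
  unfolding parabolic_def using generate.one sym_group_one by metis

lemma simple_refl_in_parabolic: "i \<in> I \<Longrightarrow> simple_refl i \<in> parabolic n I"
  unfolding parabolic_def by (simp add: generate.incl)

lemma parabolic_comp: "u \<in> parabolic n I \<Longrightarrow> v \<in> parabolic n I \<Longrightarrow> u \<circ> v \<in> parabolic n I"
  unfolding parabolic_def using generate.eng sym_group_mult by metis

lemma parabolic_inv:
  assumes "u \<in> parabolic n I" "I \<subseteq> {1..<n}"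
  shows "inv' u \<in> parabolic n I"
proof -
  have "simple_refl ` I \<subseteq> carrier (sym_group n)"
    using assms(2) by (auto simp: sym_group_carrier simple_refl_permutes subset_iff)
  then have "inv\<^bsub>sym_group n\<^esub> u \<in> parabolic n I"
    using group.generate_m_inv_closed[OF sym_group_is_group] assms(1)
    unfolding parabolic_def by blast
  then show ?thesis
    using parabolic_permutes[OF assms] by (simp add: sym_group_carrier)
qed

lemma parabolic_closed_left:
  assumes I: "I \<subseteq> {1..<n}" and u: "u \<in> parabolic n I"
    and step: "\<And>i x. i \<in> I \<Longrightarrow> x \<in> X \<Longrightarrow> simple_refl i \<circ> x \<in> X"
  shows "x \<in> X \<Longrightarrow> u \<circ> x \<in> X"
  using u unfolding parabolic_def
proof (induction u arbitrary: x rule: generate.induct)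
  case one
  then show ?case by (simp add: sym_group_one)
next
  case (incl h)
  then show ?case using step by (metis imageE)
next
  case (inv h)
  then obtain i where i: "i \<in> I" "h = simple_refl i" by auto
  then have "h \<in> carrier (sym_group n)"
    using I by (auto simp: sym_group_carrier simple_refl_permutes subset_iff)
  then have "inv\<^bsub>sym_group n\<^esub> h = simple_refl i" using i by simp
  then show ?case using step i inv by metis
next
  case (eng h1 h2)
  then show ?case by (simp add: sym_group_mult comp_assoc)
qed

lemma parabolic_closed_right:
  assumes I: "I \<subseteq> {1..<n}" and u: "u \<in> parabolic n I"
    and step: "\<And>i x. i \<in> I \<Longrightarrow> x \<in> X \<Longrightarrow> x \<circ> simple_refl i \<in> X"
  shows "x \<in> X \<Longrightarrow> x \<circ> u \<in> X"
  using u unfolding parabolic_def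
proof (induction u arbitrary: x rule: generate.induct)
  case one
  then show ?case by (simp add: sym_group_one)
next
  case (incl h)
  then show ?case using step by (metis imageE)
next
  case (inv h)
  then obtain i where i: "i \<in> I" "h = simple_refl i" by auto
  then have "h \<in> carrier (sym_group n)"
    using I by (auto simp: sym_group_carrier simple_refl_permutes subset_iff)
  then have "inv\<^bsub>sym_group n\<^esub> h = simple_refl i" using i by simp
  then show ?case using step i inv by metis
next
  case (eng h1 h2)
  then show ?case by (metis comp_assoc sym_group_mult)
qed

lemma transpose_in_parabolic:
  assumes "{l..<m} \<subseteq> I" "l \<le> m"
  shows "transpose l m \<in> parabolic n I"
  using assms(2,1)
proof (induction m rule: dec_induct)
  case base
  then show ?case using id_in_parabolic by (simp add: id_def)
next
  case (step k)
  have "k \<in> I" using step by auto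
  have eq: "transpose l (k + 1) =
      (if l = k then simple_refl k else simple_refl k \<circ> transpose l k \<circ> simple_refl k)"
    using step transpose_comp_triple[of "k + 1" l k]
    by (auto simp: simple_refl_def transpose_commute)
  have "{l..<k} \<subseteq> I" using step.prems by auto
  then have "transpose l k \<in> parabolic n I" by (rule step.IH)
  then show ?case
    using simple_refl_in_parabolic[OF \<open>k \<in> I\<close>, of n] by (simp add: eq parabolic_comp Suc_eq_plus1)
qed

lemma in_double_coset_iff:
  "y \<in> double_coset n I x J \<longleftrightarrow>
    (\<exists>u\<in>parabolic n I. \<exists>v\<in>parabolic n J. y = u \<circ> x \<circ> v)"
  by (auto simp: double_coset_def r_coset_def set_mult_def sym_group_mult)

lemma double_cosetI:
  "u \<in> parabolic n I \<Longrightarrow> v \<in> parabolic n J \<Longrightarrow> u \<circ> x \<circ> v \<in> double_coset n I x J"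
  by (auto simp: in_double_coset_iff)

lemma self_in_double_coset: "x \<in> double_coset n I x J"
  using double_cosetI[of id n I id J x] by simp

lemma double_coset_left:
  assumes "u \<in> parabolic n I" "y \<in> double_coset n I x J"
  shows "u \<circ> y \<in> double_coset n I x J"
  using assms parabolic_comp unfolding in_double_coset_iff by (metis comp_assoc)

lemma double_coset_right:
  assumes "v \<in> parabolic n J" "y \<in> double_coset n I x J"
  shows "y \<circ> v \<in> double_coset n I x J"
  using assms parabolic_comp unfolding in_double_coset_iff by (metis comp_assoc)

lemma double_coset_permutes:
  assumes "y \<in> double_coset n I x J" "I \<subseteq> {1..<n}" "J \<subseteq> {1..<n}" "x permutes {1..n}"
  shows "y permutes {1..n}"
  using assms by (auto simp: in_double_coset_iff intro!: permutes_compose intro: parabolic_permutes)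

lemma double_coset_subset:
  assumes "w \<in> X" and I: "I \<subseteq> {1..<n}" and J: "J \<subseteq> {1..<n}"
    and "\<And>i x. i \<in> I \<Longrightarrow> x \<in> X \<Longrightarrow> simple_refl i \<circ> x \<in> X"
    and "\<And>j x. j \<in> J \<Longrightarrow> x \<in> X \<Longrightarrow> x \<circ> simple_refl j \<in> X"
  shows "double_coset n I w J \<subseteq> X"
proof
  fix y assume "y \<in> double_coset n I w J"
  then obtain u v where uv: "u \<in> parabolic n I" "v \<in> parabolic n J" "y = u \<circ> w \<circ> v"
    by (auto simp: in_double_coset_iff)
  have "u \<circ> w \<in> X" using parabolic_closed_left[OF I uv(1) assms(4) assms(1)] .
  then show "y \<in> X" using parabolic_closed_right[OF J uv(2) assms(5)] uv(3) by simp
qed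

lemma double_coset_inv:
  assumes "I \<subseteq> {1..<n}" "J \<subseteq> {1..<n}" "x permutes {1..n}"
  shows "y \<in> double_coset n I x J \<Longrightarrow> inv' y \<in> double_coset n J (inv' x) I"
proof -
  assume "y \<in> double_coset n I x J"
  then obtain u v where uv: "u \<in> parabolic n I" "v \<in> parabolic n J" "y = u \<circ> x \<circ> v"
    by (auto simp: in_double_coset_iff)
  have "bij u" "bij v" "bij x"
    using uv assms permutes_bij parabolic_permutes by metis+
  then have "inv' y = inv' v \<circ> inv' x \<circ> inv' u"
    using uv(3) by (simp add: o_inv_distrib bij_comp comp_assoc)
  then show ?thesis
    using uv assms by (auto intro!: double_cosetI parabolic_inv)
qed

lemma double_coset_rebase:
  assumes I: "I \<subseteq> {1..<n}" and J: "J \<subseteq> {1..<n}" and x: "x permutes {1..n}"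
    and y: "y \<in> double_coset n I x J"
  shows "double_coset n I y J = double_coset n I x J"
proof
  show "double_coset n I y J \<subseteq> double_coset n I x J"
    by (rule double_coset_subset[OF y I J])
      (auto intro: double_coset_left double_coset_right simple_refl_in_parabolic)
  obtain u v where uv: "u \<in> parabolic n I" "v \<in> parabolic n J" "y = u \<circ> x \<circ> v"
    using y by (auto simp: in_double_coset_iff)
  have "u permutes {1..n}" "v permutes {1..n}"
    using uv I J parabolic_permutes by metis+
  then have "inv' u \<circ> y \<circ> inv' v = x"
    using uv(3) by (auto simp: fun_eq_iff permutes_inverses)
  then have "x \<in> double_coset n I y J"
    using double_cosetI[OF parabolic_inv[OF uv(1) I] parabolic_inv[OF uv(2) J], of y] by simp
  then show "double_coset n I x J \<subseteq> double_coset n I y J"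
    by (rule double_coset_subset[OF _ I J])
      (auto intro: double_coset_left double_coset_right simple_refl_in_parabolic)
qed

lemma Asc_R_inv: "w permutes {1..n} \<Longrightarrow> Asc_R n (inv' w) = Asc_L n w"
  by (simp add: Asc_R_def Asc_L_def)

lemma Asc_L_inv: "w permutes {1..n} \<Longrightarrow> Asc_L n (inv' w) = Asc_R n w"
  by (simp add: Asc_R_def Asc_L_def permutes_inv_inv)

lemma small_Asc_L_inv: "w permutes {1..n} \<Longrightarrow> small_Asc_L n (inv' w) = small_Asc_R n w"
  by (simp add: small_Asc_R_def small_Asc_L_def permutes_inv_inv)

section \<open>Blocks\<close>

text \<open>\<open>block I\<close> numbers the orbits of the parabolic subgroup of \<open>I\<close> from left to right.\<close>

definition block :: "nat set \<Rightarrow> nat \<Rightarrow> nat" where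
  "block I k = card ({..<k} - I)"

lemma block_eq_iff: "k \<le> l \<Longrightarrow> block I k = block I l \<longleftrightarrow> {k..<l} \<subseteq> I"
proof -
  assume "k \<le> l"
  then have "{..<l} - I = ({..<k} - I) \<union> ({k..<l} - I)" by auto
  then have "block I l = block I k + card ({k..<l} - I)"
    unfolding block_def by (simp add: card_Un_disjoint disjoint_iff)
  then have "block I k = block I l \<longleftrightarrow> {k..<l} - I = {}"
    by (metis add_cancel_left_right card_0_eq finite_Diff finite_atLeastLessThan)
  then show ?thesis by auto
qed

lemma block_mono: "k \<le> l \<Longrightarrow> block I k \<le> block I l"
  unfolding block_def by (intro card_mono) auto

lemma block_simple_refl:
  assumes "i \<in> I"
  shows "block I (simple_refl i k) = block I k"
proof -
  have "{i..<i + 1} = {i}" by auto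
  then have "block I i = block I (i + 1)"
    using block_eq_iff[of i "i + 1" I] assms by simp
  then show ?thesis
    by (cases "k = i"; cases "k = i + 1") simp_all
qed

lemma block_parabolic:
  assumes "u \<in> parabolic n I" "I \<subseteq> {1..<n}"
  shows "block I (u k) = block I k"
  using parabolic_closed_left[OF assms(2,1), of "{f. \<forall>k. block I (f k) = block I k}" id]
  by (auto simp: block_simple_refl)

lemma parabolic_le_iff:
  assumes "u \<in> parabolic n I" "I \<subseteq> {1..<n}" "i \<notin> I"
  shows "u k \<le> i \<longleftrightarrow> k \<le> i"
proof -
  have ne: "block I k \<noteq> block I l" if "k \<le> i" "i < l" for k l
    using block_eq_iff[of k l I] that assms(3) by auto
  show ?thesis
    using ne[of k "u k"] ne[of "u k" k] block_parabolic[OF assms(1,2), of k]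
    by (metis not_le)
qed

lemma mono_blocks_unique:
  fixes f g :: "nat \<Rightarrow> nat"
  assumes v: "v permutes S" "finite S"
    and vb: "\<And>k. block K (v k) = block K k"
    and g: "\<And>k. k \<in> S \<Longrightarrow> g k = f (v k)"
    and f_mono: "\<And>k l. k \<in> S \<Longrightarrow> l \<in> S \<Longrightarrow> block K k = block K l \<Longrightarrow> k \<le> l \<Longrightarrow> f k \<le> f l"
    and g_mono: "\<And>k l. k \<in> S \<Longrightarrow> l \<in> S \<Longrightarrow> block K k = block K l \<Longrightarrow> k \<le> l \<Longrightarrow> g k \<le> g l"
    and k: "k \<in> S"
  shows "g k = f k"
proof -
  define B where "B = {l \<in> S. block K l = block K k}"
  have fin: "finite B" using v unfolding B_def by simp
  have eq: "{l \<in> B. g l \<le> c} = {l \<in> B. f l \<le> c}" for c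
  proof -
    have "v ` {l \<in> B. g l \<le> c} = {l \<in> B. f l \<le> c}"
    proof (intro equalityI subsetI)
      fix l assume l: "l \<in> {l \<in> B. f l \<le> c}"
      define m where "m = inv' v l"
      have "v m = l" using permutes_inverses(1)[OF v(1)] by (simp add: m_def)
      moreover have "m \<in> S"
        using l permutes_in_image[OF permutes_inv[OF v(1)]] by (simp add: m_def B_def)
      ultimately have "m \<in> {l \<in> B. g l \<le> c}"
        using l vb[of m] g[of m] by (simp add: B_def)
      then show "l \<in> v ` {l \<in> B. g l \<le> c}" using \<open>v m = l\<close> by blast
    next
      fix m assume "m \<in> v ` {l \<in> B. g l \<le> c}"
      then obtain l where "l \<in> S" "block K l = block K k" "g l \<le> c" "m = v l"
        by (auto simp: B_def)
      then show "m \<in> {l \<in> B. f l \<le> c}"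
        using vb[of l] g[of l] permutes_in_image[OF v(1)] by (simp add: B_def)
    qed
    moreover have "inj_on v {l \<in> B. g l \<le> c}"
      by (rule permutes_inj_on[OF v(1)])
    ultimately have card: "card {l \<in> B. g l \<le> c} = card {l \<in> B. f l \<le> c}"
      using card_image by fastforce
    have "{l \<in> B. g l \<le> c} \<subseteq> {l \<in> B. f l \<le> c} \<or> {l \<in> B. f l \<le> c} \<subseteq> {l \<in> B. g l \<le> c}"
    proof (rule ccontr)
      assume "\<not> ?thesis"
      then obtain p q where pq: "p \<in> B" "g p \<le> c" "\<not> f p \<le> c" "q \<in> B" "f q \<le> c" "\<not> g q \<le> c"
        by blast
      have S: "p \<in> S" "q \<in> S" and b: "block K p = block K q"
        using pq by (simp_all add: B_def)
      show False
      proof (cases "p \<le> q")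
        case True
        then show False using f_mono[OF S b] pq by linarith
      next
        case False
        then show False using g_mono[OF S(2,1) b[symmetric]] pq by linarith
      qed
    qed
    then show ?thesis
    proof
      assume "{l \<in> B. g l \<le> c} \<subseteq> {l \<in> B. f l \<le> c}"
      then show ?thesis by (rule card_subset_eq[rotated]) (use fin card in simp_all)
    next
      assume "{l \<in> B. f l \<le> c} \<subseteq> {l \<in> B. g l \<le> c}"
      then show ?thesis by (rule card_subset_eq[rotated, symmetric]) (use fin card in simp_all)
    qed
  qed
  have "k \<in> B" using k by (simp add: B_def)
  then have "k \<in> {l \<in> B. g l \<le> f k}" "k \<in> {l \<in> B. f l \<le> g k}"
    unfolding eq[of "f k"] eq[of "g k", symmetric] by simp_all
  then show ?thesis by simp
qed

section \<open>Length and Bruhat order\<close>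

definition inversions :: "nat \<Rightarrow> (nat \<Rightarrow> nat) \<Rightarrow> (nat \<times> nat) set" where
  "inversions n u = {(a, b). 1 \<le> a \<and> a < b \<and> b \<le> n \<and> u b < u a}"

lemma finite_inversions [simp]: "finite (inversions n u)"
  by (rule finite_subset[of _ "{1..n} \<times> {1..n}"]) (auto simp: inversions_def)

lemma simple_refl_less:
  assumes "a < b" "(a, b) \<noteq> (j, j + 1)"
  shows "simple_refl j a < simple_refl j b"
  using assms by (cases "a = j"; cases "a = j + 1"; cases "b = j"; cases "b = j + 1") auto

lemma card_inversions_ascent:
  assumes j: "j \<in> {1..<n}" and asc: "u j < u (j + 1)"
  shows "card (inversions n (u \<circ> simple_refl j)) = Suc (card (inversions n u))"
proof -
  let ?s = "simple_refl j" and ?f = "map_prod (simple_refl j) (simple_refl j)"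
  have range: "?s k \<in> {1..n} \<longleftrightarrow> k \<in> {1..n}" for k
    using permutes_in_image[OF simple_refl_permutes[OF j]] .
  have "inversions n (u \<circ> ?s) = insert (j, j + 1) (?f ` inversions n u)"
  proof (intro equalityI subrelI)
    fix a b assume ab: "(a, b) \<in> inversions n (u \<circ> ?s)"
    show "(a, b) \<in> insert (j, j + 1) (?f ` inversions n u)"
    proof (cases "(a, b) = (j, j + 1)")
      case False
      then have "?s a < ?s b" using ab by (intro simple_refl_less) (auto simp: inversions_def)
      then have "(?s a, ?s b) \<in> inversions n u"
        using ab range[of a] range[of b] by (auto simp: inversions_def)
      then have "?f (?s a, ?s b) \<in> ?f ` inversions n u" by (rule imageI)
      then show ?thesis by simp
    qed simp
  next
    fix a b assume "(a, b) \<in> insert (j, j + 1) (?f ` inversions n u)"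
    then show "(a, b) \<in> inversions n (u \<circ> ?s)"
    proof
      assume "(a, b) = (j, j + 1)"
      then show ?thesis using j asc by (auto simp: inversions_def)
    next
      assume "(a, b) \<in> ?f ` inversions n u"
      then obtain c d where cd: "(c, d) \<in> inversions n u" "a = ?s c" "b = ?s d" by auto
      then have "(c, d) \<noteq> (j, j + 1)" using asc by (auto simp: inversions_def)
      then have "a < b" using cd by (auto simp: inversions_def intro!: simple_refl_less)
      then show ?thesis
        using cd range[of c] range[of d] by (auto simp: inversions_def)
    qed
  qed
  moreover have "(j, j + 1) \<notin> ?f ` inversions n u"
  proof
    assume "(j, j + 1) \<in> ?f ` inversions n u"
    then obtain c d where cd: "(c, d) \<in> inversions n u" "j = ?s c" "j + 1 = ?s d" by auto
    then have "c = j + 1" "d = j" by (metis simple_refl_eq(1) simple_refl_involutory(2))+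
    then show False using cd(1) by (simp add: inversions_def)
  qed
  moreover have "inj ?f"
    by (rule prod.inj_map) (simp_all add: simple_refl_def)
  then have "card (?f ` inversions n u) = card (inversions n u)"
    by (intro card_image) (rule inj_on_subset[OF _ subset_UNIV])
  ultimately show ?thesis by simp
qed

lemma card_inversions_descent:
  assumes j: "j \<in> {1..<n}" and "u (j + 1) < u j"
  shows "card (inversions n u) = Suc (card (inversions n (u \<circ> simple_refl j)))"
  using card_inversions_ascent[OF j, of "u \<circ> simple_refl j"] assms(2)
  by (simp add: comp_assoc)

lemma card_inversions_inv:
  assumes "u permutes {1..n}"
  shows "card (inversions n (inv' u)) = card (inversions n u)"
proof -
  have le: "card (inversions n w) \<le> card (inversions n (inv' w))" if w: "w permutes {1..n}" for w
  proof (rule card_inj_on_le)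
    show "inj_on (\<lambda>(a, b). (w b, w a)) (inversions n w)"
      using permutes_inj[OF w] by (auto simp: inj_on_def)
    have "1 \<le> w k \<and> w k \<le> n" if "1 \<le> k" "k \<le> n" for k
      using permutes_in_image[OF w, of k] that by simp
    then show "(\<lambda>(a, b). (w b, w a)) ` inversions n w \<subseteq> inversions n (inv' w)"
      by (auto simp: inversions_def permutes_inverses[OF w])
  qed simp
  show ?thesis
    using le[OF assms] le[OF permutes_inv[OF assms]] permutes_inv_inv[OF assms] by simp
qed

lemma ascending_permutation_id:
  fixes w :: "nat \<Rightarrow> nat"
  assumes w: "w permutes {1..n}" and asc: "\<And>j. j \<in> {1..<n} \<Longrightarrow> w j < w (j + 1)"
  shows "w = id"
proof (rule permutes_natset_ge[OF w], rule ballI)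
  fix i assume "i \<in> {1..n}"
  then show "i \<le> w i"
  proof (induction i)
    case (Suc i)
    show ?case
    proof (cases "i = 0")
      case True
      then show ?thesis using permutes_in_image[OF w, of "Suc i"] Suc.prems by simp
    next
      case False
      then show ?thesis using Suc asc[of i] by (simp add: Suc_eq_plus1)
    qed
  qed simp
qed

lemma foldr_comp_append: "foldr (\<circ>) (xs @ [f]) id = foldr (\<circ>) xs id \<circ> f"
  by (induction xs) (simp_all add: comp_assoc)

lemma reduced_word_exists:
  assumes "w permutes {1..n}"
  shows "\<exists>is. length is = card (inversions n w) \<and> set is \<subseteq> {1..<n} \<and>
    w = foldr (\<circ>) (map simple_refl is) id"
  using assms
proof (induction "card (inversions n w)" arbitrary: w rule: less_induct)
  case less
  show ?case
  proof (cases "\<forall>j\<in>{1..<n}. w j < w (j + 1)")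
    case True
    then have "w = id" using ascending_permutation_id[OF less.prems] by blast
    then have "inversions n w = {}" by (auto simp: inversions_def)
    then show ?thesis using \<open>w = id\<close> by simp
  next
    case False
    then obtain j where j: "j \<in> {1..<n}" "\<not> w j < w (j + 1)" by blast
    have "w j \<noteq> w (j + 1)"
      using permutes_inj[OF less.prems] by (simp add: inj_eq)
    then have c: "card (inversions n w) = Suc (card (inversions n (w \<circ> simple_refl j)))"
      using j by (intro card_inversions_descent) auto
    have "w \<circ> simple_refl j permutes {1..n}"
      using less.prems simple_refl_permutes[OF j(1)] by (intro permutes_compose)
    then obtain js where js: "length js = card (inversions n (w \<circ> simple_refl j))"
      "set js \<subseteq> {1..<n}" "w \<circ> simple_refl j = foldr (\<circ>) (map simple_refl js) id"
      using less.hyps[of "w \<circ> simple_refl j"] c by auto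
    have "w = foldr (\<circ>) (map simple_refl (js @ [j])) id"
      by (simp only: map_append list.map foldr_comp_append js(3)[symmetric])
        (simp add: comp_assoc)
    then show ?thesis
      using js(1,2) c j(1) by (intro exI[of _ "js @ [j]"]) auto
  qed
qed

lemma card_inversions_word:
  assumes "set is \<subseteq> {1..<n}"
  shows "card (inversions n (foldr (\<circ>) (map simple_refl is) id)) \<le> length is"
  using assms
proof (induction "is" rule: rev_induct)
  case Nil
  have "inversions n id = {}" by (auto simp: inversions_def)
  then show ?case by (simp add: id_def)
next
  case (snoc j js)
  let ?u = "foldr (\<circ>) (map simple_refl js) id"
  have j: "j \<in> {1..<n}" using snoc.prems by auto
  have IH: "card (inversions n ?u) \<le> length js"
    by (rule snoc.IH) (use snoc.prems in simp)
  have "card (inversions n (?u \<circ> simple_refl j)) \<le> Suc (card (inversions n ?u))"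
  proof (cases "?u j < ?u (j + 1)")
    case True
    then show ?thesis using card_inversions_ascent[OF j] by simp
  next
    case False
    have "bij ?u"
    proof (induction js)
      case Nil
      show ?case using bij_id by (simp add: id_def)
    next
      case (Cons k ks)
      have eq: "foldr (\<circ>) (map simple_refl (k # ks)) id =
          simple_refl k \<circ> foldr (\<circ>) (map simple_refl ks) id" by simp
      show ?case
        unfolding eq by (rule bij_comp[OF Cons.IH]) (simp add: simple_refl_def)
    qed
    then have "?u j \<noteq> ?u (j + 1)" by (simp add: bij_is_inj inj_eq)
    then show ?thesis using False card_inversions_descent[OF j, of ?u] by simp
  qed
  moreover have "length (js @ [j]) = Suc (length js)" by simp
  ultimately show ?case
    using IH unfolding map_append list.map foldr_comp_append by linarith
qed

lemma coxeter_length_eq: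
  assumes "w permutes {1..n}"
  shows "coxeter_length n w = card (inversions n w)"
  unfolding coxeter_length_def
proof (rule Least_equality)
  show "\<exists>is. length is = card (inversions n w) \<and> set is \<subseteq> {1..<n} \<and>
      w = foldr (\<circ>) (map simple_refl is) id"
    by (rule reduced_word_exists[OF assms])
qed (use card_inversions_word in auto)

lemma bruhat_le_length: "bruhat_le n u v \<Longrightarrow> coxeter_length n u \<le> coxeter_length n v"
  unfolding bruhat_le_def
  by (induction rule: rtranclp_induct) (auto simp: bruhat_step_def)

lemma simple_refl_comp:
  "bij w \<Longrightarrow> simple_refl i \<circ> w = w \<circ> transpose (inv' w i) (inv' w (i + 1))"
  unfolding simple_refl_def by (rule transpose_comp_eq)

lemma length_left_descent:
  assumes w: "w permutes {1..n}" and i: "i \<in> {1..<n}" "i \<notin> Asc_L n w"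
  shows "coxeter_length n (simple_refl i \<circ> w) < coxeter_length n w"
proof -
  note s = simple_refl_permutes[OF i(1)]
  have "inv' w i \<noteq> inv' w (i + 1)"
    using permutes_inj[OF permutes_inv[OF w]] by (simp add: inj_eq)
  then have "inv' w (i + 1) < inv' w i" using i by (auto simp: Asc_L_def)
  then have "card (inversions n (inv' w)) = Suc (card (inversions n (inv' w \<circ> simple_refl i)))"
    by (rule card_inversions_descent[OF i(1)])
  moreover have "inv' w \<circ> simple_refl i = inv' (simple_refl i \<circ> w)"
    using permutes_bij[OF s] permutes_bij[OF w] by (simp add: o_inv_distrib)
  ultimately show ?thesis
    using w permutes_compose[OF w s] by (simp add: coxeter_length_eq card_inversions_inv)
qed

lemma length_right_descent:
  assumes w: "w permutes {1..n}" and j: "j \<in> {1..<n}" "j \<notin> Asc_R n w"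
  shows "coxeter_length n (w \<circ> simple_refl j) < coxeter_length n w"
proof -
  have "w j \<noteq> w (j + 1)"
    using permutes_inj[OF w] by (simp add: inj_eq)
  then have "w (j + 1) < w j" using j by (auto simp: Asc_R_def)
  then show ?thesis
    using card_inversions_descent[OF j(1)] w
      permutes_compose[OF simple_refl_permutes[OF j(1)] w]
    by (simp add: coxeter_length_eq)
qed

lemma bruhat_step_left_descent:
  assumes w: "w permutes {1..n}" and i: "i \<in> {1..<n}" "i \<notin> Asc_L n w"
  shows "bruhat_step n (simple_refl i \<circ> w) w"
  unfolding bruhat_step_def
proof (intro conjI exI)
  note w' = permutes_inv[OF w]
  let ?a = "inv' w (i + 1)" and ?b = "inv' w i"
  show "simple_refl i \<circ> w \<in> carrier (sym_group n)"
    using permutes_compose[OF w simple_refl_permutes[OF i(1)]] by (simp add: sym_group_carrier)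
  show "1 \<le> ?a" "?b \<le> n"
    using i permutes_in_image[OF w', of i] permutes_in_image[OF w', of "i + 1"] by auto
  have "?a \<noteq> ?b" using permutes_inj[OF w'] by (simp add: inj_eq)
  then show "?a < ?b" using i by (auto simp: Asc_L_def)
  show "w = (simple_refl i \<circ> w) \<otimes>\<^bsub>sym_group n\<^esub> transpose ?a ?b"
    unfolding sym_group_mult simple_refl_comp[OF permutes_bij[OF w]]
    by (simp add: comp_assoc transpose_commute)
  show "coxeter_length n (simple_refl i \<circ> w) < coxeter_length n w"
    by (rule length_left_descent[OF assms])
qed

lemma bruhat_step_right_descent:
  assumes w: "w permutes {1..n}" and j: "j \<in> {1..<n}" "j \<notin> Asc_R n w"
  shows "bruhat_step n (w \<circ> simple_refl j) w"
  unfolding bruhat_step_def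
proof (intro conjI exI)
  show "w \<circ> simple_refl j \<in> carrier (sym_group n)"
    using permutes_compose[OF simple_refl_permutes[OF j(1)] w] by (simp add: sym_group_carrier)
  show "w = (w \<circ> simple_refl j) \<otimes>\<^bsub>sym_group n\<^esub> transpose j (j + 1)"
    unfolding sym_group_mult by (simp add: simple_refl_def comp_assoc)
  show "coxeter_length n (w \<circ> simple_refl j) < coxeter_length n w"
    by (rule length_right_descent[OF assms])
qed (use j in auto)

section \<open>The minimal element of a double coset\<close>

lemma ascending_run:
  assumes "J \<subseteq> Asc_R n w" "{p..<q} \<subseteq> J" "p < q"
  shows "w p < w q"
proof (rule lift_Suc_mono_less_ivl[of J w p q])
  show "w k < w (Suc k)" if "k \<in> J" for k using assms(1) that by (auto simp: Asc_R_def Suc_eq_plus1)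
qed (use assms in auto)

lemma ascending_block:
  assumes "J \<subseteq> Asc_R n w" "block J p = block J q" "p \<le> q"
  shows "w p \<le> w q"
  using ascending_run[OF assms(1), of p q] assms(2,3) block_eq_iff[of p q J]
  by (cases "p = q") auto

lemma minimal_element_unique:
  assumes w: "w permutes {1..n}" and yC: "y \<in> double_coset n I w J"
    and I: "I \<subseteq> Asc_L n w" "I \<subseteq> Asc_L n y" and J: "J \<subseteq> Asc_R n w" "J \<subseteq> Asc_R n y"
  shows "y = w"
proof -
  have In: "I \<subseteq> {1..<n}" and Jn: "J \<subseteq> {1..<n}" using I J by (auto simp: Asc_L_def Asc_R_def)
  have y: "y permutes {1..n}" by (rule double_coset_permutes[OF yC In Jn w])
  obtain u v where u: "u \<in> parabolic n I" and v: "v \<in> parabolic n J" and y_eq: "y = u \<circ> w \<circ> v"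
    using yC by (auto simp: in_double_coset_iff)
  have same: "block I (y k) = block I (w k)" for k
  proof (cases "k \<in> {1..n}")
    case True
    show ?thesis
    proof (rule mono_blocks_unique[where f = "\<lambda>k. block I (w k)" and
            g = "\<lambda>k. block I (y k)" and v = v and S = "{1..n}" and K = J])
      show "v permutes {1..n}" by (rule parabolic_permutes[OF v Jn])
      show "block J (v k) = block J k" for k by (rule block_parabolic[OF v Jn])
      show "block I (y k) = block I (w (v k))" for k
        by (simp add: y_eq block_parabolic[OF u In])
    qed (use J True in \<open>auto intro!: block_mono intro: ascending_block\<close>)
  next
    case False
    then show ?thesis using w y by (metis permutes_not_in)
  qed
  have "inv' y k = inv' w k" for k
  proof (cases "k \<in> {1..n}")
    case True
    show ?thesis
    proof (rule mono_blocks_unique[where f = "inv' w" and g = "inv' y" and v = "w \<circ> inv' y" and S = "{1..n}" and K = I])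
      show "w \<circ> inv' y permutes {1..n}" by (intro permutes_compose permutes_inv w y)
      show "block I ((w \<circ> inv' y) k) = block I k" for k
        using same[of "inv' y k"] permutes_inverses(1)[OF y] by simp
      show "inv' y k = inv' w ((w \<circ> inv' y) k)" for k
        using permutes_inverses(2)[OF w] by simp
    qed (use True I[folded Asc_R_inv[OF w] Asc_R_inv[OF y]] in \<open>auto intro: ascending_block\<close>)
  next
    case False
    then show ?thesis using permutes_inv[OF w] permutes_inv[OF y] by (metis permutes_not_in)
  qed
  then show ?thesis using permutes_inv_inv[OF w] permutes_inv_inv[OF y] by (metis ext)
qed

lemma bruhat_least_double_coset:
  assumes w: "w permutes {1..n}" and I: "I \<subseteq> Asc_L n w" and J: "J \<subseteq> Asc_R n w"
  shows "bruhat_least n (double_coset n I w J) w"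
  unfolding bruhat_least_def
proof (intro conjI ballI)
  show "w \<in> double_coset n I w J" by (rule self_in_double_coset)
  have In: "I \<subseteq> {1..<n}" and Jn: "J \<subseteq> {1..<n}" using I J by (auto simp: Asc_L_def Asc_R_def)
  fix y assume "y \<in> double_coset n I w J"
  then show "bruhat_le n w y"
  proof (induction "coxeter_length n y" arbitrary: y rule: less_induct)
    case less
    have y: "y permutes {1..n}" by (rule double_coset_permutes[OF less.prems In Jn w])
    have step: "bruhat_le n w y" if "bruhat_step n z y" "z \<in> double_coset n I w J" for z
    proof -
      have "bruhat_le n w z" using less.hyps that by (simp add: bruhat_step_def)
      then show ?thesis
        using that(1) unfolding bruhat_le_def by (meson rtranclp.rtrancl_into_rtrancl)
    qed
    consider i where "i \<in> I" "i \<notin> Asc_L n y" | j where "j \<in> J" "j \<notin> Asc_R n y" | "y = w"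
      using minimal_element_unique[OF w less.prems I _ J] by blast
    then show ?case
    proof cases
      case (1 i)
      then show ?thesis
        using In y less.prems
        by (intro step[of "simple_refl i \<circ> y"] bruhat_step_left_descent)
          (auto intro: double_coset_left simple_refl_in_parabolic)
    next
      case (2 j)
      then show ?thesis
        using Jn y less.prems
        by (intro step[of "y \<circ> simple_refl j"] bruhat_step_right_descent)
          (auto intro: double_coset_right simple_refl_in_parabolic)
    qed (simp add: bruhat_le_def)
  qed
qed

lemma bruhat_least_Asc:
  assumes w: "w permutes {1..n}" and I: "I \<subseteq> {1..<n}" and J: "J \<subseteq> {1..<n}"
    and least: "bruhat_least n (double_coset n I w J) w"
  shows "I \<subseteq> Asc_L n w" "J \<subseteq> Asc_R n w"
proof -
  have le: "coxeter_length n w \<le> coxeter_length n y" if "y \<in> double_coset n I w J" for y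
    using least that by (auto simp: bruhat_least_def intro: bruhat_le_length)
  have "coxeter_length n w \<le> coxeter_length n (simple_refl i \<circ> w)" if "i \<in> I" for i
    using that by (intro le double_coset_left simple_refl_in_parabolic self_in_double_coset)
  then show "I \<subseteq> Asc_L n w" using length_left_descent[OF w] I by (meson not_less subset_iff)
  have "coxeter_length n w \<le> coxeter_length n (w \<circ> simple_refl j)" if "j \<in> J" for j
    using that by (intro le double_coset_right simple_refl_in_parabolic self_in_double_coset)
  then show "J \<subseteq> Asc_R n w" using length_right_descent[OF w] J by (meson not_less subset_iff)
qed

section \<open>Moving generators across the double coset\<close>

lemma parabolic_commute:
  assumes "I \<subseteq> {1..<n}" "u \<in> parabolic n I" "\<And>i. i \<in> I \<Longrightarrow> f \<circ> simple_refl i = simple_refl i \<circ> f"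
  shows "f \<circ> u = u \<circ> f"
proof -
  have "u \<circ> id \<in> {x. f \<circ> x = x \<circ> f}"
    by (rule parabolic_closed_left[OF assms(1,2)]) (use assms(3) in \<open>auto simp: fun_eq_iff\<close>)
  then show ?thesis by simp
qed

lemma small_Asc_L_comp:
  assumes "w permutes {1..n}" "a \<in> small_Asc_L n w"
  shows "simple_refl a \<circ> w = w \<circ> simple_refl (inv' w a)"
  using simple_refl_comp[OF permutes_bij[OF assms(1)], of a] assms(2)
  by (simp add: small_Asc_L_def simple_refl_def)

lemma small_Asc_L_range:
  assumes "w permutes {1..n}" "a \<in> small_Asc_L n w"
  shows "inv' w a \<in> {1..<n}"
  using permutes_in_image[OF permutes_inv[OF assms(1)], of a]
    permutes_in_image[OF permutes_inv[OF assms(1)], of "a + 1"] assms(2)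
  by (auto simp: small_Asc_L_def)

text \<open>For each side, either the new generators are already present there, or they commute with all
  generators there; these are the situations that the conditions of the theorem rule out.\<close>

lemma double_coset_move:
  assumes w: "w permutes {1..n}" and I: "I \<subseteq> {1..<n}" and J: "J \<subseteq> {1..<n}"
    and A: "A \<subseteq> small_Asc_L n w"
    and left: "A \<subseteq> I \<or> (\<forall>a\<in>A. \<forall>i\<in>I. i \<noteq> a + 1 \<and> a \<noteq> i + 1)"
    and right: "inv' w ` A \<subseteq> J \<or> (\<forall>p\<in>inv' w ` A. \<forall>j\<in>J. j \<noteq> p + 1 \<and> p \<noteq> j + 1)"
  shows "double_coset n (I \<union> A) w J = double_coset n I w (J \<union> inv' w ` A)"
    (is "?X = double_coset n I w (J \<union> ?P)")
proof
  have An: "A \<subseteq> {1..<n}" using A by (auto simp: small_Asc_L_def)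
  have Pn: "?P \<subseteq> {1..<n}" using small_Asc_L_range[OF w] A by blast
  have IA: "I \<union> A \<subseteq> {1..<n}" and JP: "J \<union> ?P \<subseteq> {1..<n}" using I J An Pn by auto
  show "?X \<subseteq> double_coset n I w (J \<union> ?P)"
  proof (rule double_coset_subset[OF self_in_double_coset IA J])
    fix i x assume i: "i \<in> I \<union> A" and x: "x \<in> double_coset n I w (J \<union> ?P)"
    show "simple_refl i \<circ> x \<in> double_coset n I w (J \<union> ?P)"
    proof (cases "i \<in> I")
      case True
      then show ?thesis using x by (intro double_coset_left simple_refl_in_parabolic)
    next
      case False
      obtain u v where uv: "u \<in> parabolic n I" "v \<in> parabolic n (J \<union> ?P)" "x = u \<circ> w \<circ> v"
        using x by (auto simp: in_double_coset_iff)
      have "simple_refl i \<circ> u = u \<circ> simple_refl i"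
        using left False i by (intro parabolic_commute[OF I uv(1)] simple_refl_commute) auto
      moreover have "simple_refl i \<circ> w = w \<circ> simple_refl (inv' w i)"
        using A False i by (intro small_Asc_L_comp[OF w]) auto
      ultimately have "simple_refl i \<circ> x = u \<circ> w \<circ> (simple_refl (inv' w i) \<circ> v)"
        unfolding uv(3) by (metis comp_assoc)
      then show ?thesis
        using uv False i by (auto intro!: double_cosetI parabolic_comp simple_refl_in_parabolic)
    qed
  qed (auto intro: double_coset_right simple_refl_in_parabolic)
  show "double_coset n I w (J \<union> ?P) \<subseteq> ?X"
  proof (rule double_coset_subset[OF self_in_double_coset I JP])
    fix j x assume j: "j \<in> J \<union> ?P" and x: "x \<in> ?X"
    show "x \<circ> simple_refl j \<in> ?X"
    proof (cases "j \<in> J")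
      case True
      then show ?thesis using x by (intro double_coset_right simple_refl_in_parabolic)
    next
      case False
      then obtain a where a: "a \<in> A" "j = inv' w a" using j by auto
      obtain u v where uv: "u \<in> parabolic n (I \<union> A)" "v \<in> parabolic n J" "x = u \<circ> w \<circ> v"
        using x by (auto simp: in_double_coset_iff)
      have "simple_refl j \<circ> v = v \<circ> simple_refl j"
        using right False j by (intro parabolic_commute[OF J uv(2)] simple_refl_commute) auto
      moreover have "simple_refl a \<circ> w = w \<circ> simple_refl j"
        using A a by (auto intro: small_Asc_L_comp[OF w])
      ultimately have "x \<circ> simple_refl j = (u \<circ> simple_refl a) \<circ> w \<circ> v"
        unfolding uv(3) by (metis comp_assoc)
      then show ?thesis
        using uv a by (auto intro!: double_cosetI parabolic_comp simple_refl_in_parabolic)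
    qed
  qed (auto intro: double_coset_left simple_refl_in_parabolic)
qed

section \<open>Comparing two presentations with the same minimal element\<close>

text \<open>As \<open>i \<notin> I\<close>, the subgroup of \<open>I\<close> preserves \<open>{..i}\<close>, so every block of positions contains
  equally many values \<open>\<le> i\<close> in \<open>y\<close> and in \<open>w\<close>.\<close>

lemma block_eq_of_exchange:
  assumes w: "w permutes {1..n}" and I: "I \<subseteq> {1..<n}" and J: "J \<subseteq> {1..<n}"
    and y: "y \<in> double_coset n I w J" and i: "i \<notin> I"
    and low: "{k. y k \<le> i} = insert z ({k. w k \<le> i} - {x})" and x: "w x \<le> i"
  shows "block J x = block J z"
proof (rule ccontr)
  assume ne: "block J x \<noteq> block J z"
  obtain u v where u: "u \<in> parabolic n I" and v: "v \<in> parabolic n J" and y_eq: "y = u \<circ> w \<circ> v"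
    using y by (auto simp: in_double_coset_iff)
  define B where "B f = {k. block J k = block J x \<and> f k \<le> i}" for f :: "nat \<Rightarrow> nat"
  have vp: "v permutes {1..n}" by (rule parabolic_permutes[OF v J])
  have "v ` B y = B w"
  proof (intro equalityI subsetI)
    fix k assume "k \<in> B w"
    then have "inv' v k \<in> B y" "k = v (inv' v k)"
      using block_parabolic[OF v J, of "inv' v k"] permutes_inverses(1)[OF vp]
      by (auto simp: B_def y_eq parabolic_le_iff[OF u I i])
    then show "k \<in> v ` B y" by (rule image_eqI[rotated])
  next
    fix k assume "k \<in> v ` B y"
    then show "k \<in> B w"
      using block_parabolic[OF v J] by (auto simp: B_def y_eq parabolic_le_iff[OF u I i])
  qed
  then have "card (B w) = card (B y)"
    using card_image[OF inj_on_subset[OF permutes_inj[OF vp]], of "B y"] by simp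
  moreover have "B y = B w - {x}"
    using ne low by (auto simp: B_def set_eq_iff)
  moreover have "x \<in> B w" using x by (simp add: B_def)
  moreover have "finite (B w)"
  proof (rule finite_subset)
    show "B w \<subseteq> inv' w ` {..i}"
      by (auto simp: B_def image_iff permutes_inverses(2)[OF w] intro!: bexI[of _ "w _"])
  qed simp
  ultimately show False by (metis card_Diff1_less less_irrefl)
qed

locale two_presentations =
  fixes n :: nat and w :: "nat \<Rightarrow> nat" and I J I' J' :: "nat set"
  assumes w: "w permutes {1..n}"
    and I: "I \<subseteq> Asc_L n w" and J: "J \<subseteq> Asc_R n w"
    and I': "I' \<subseteq> Asc_L n w" and J': "J' \<subseteq> Asc_R n w"
    and same: "double_coset n I w J = double_coset n I' w J'"
begin

lemma swap: "two_presentations n w I' J' I J"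
  by unfold_locales (use w I J I' J' same in auto)

lemma index_ranges: "I \<subseteq> {1..<n}" "J \<subseteq> {1..<n}" "I' \<subseteq> {1..<n}" "J' \<subseteq> {1..<n}"
  using I J I' J' by (auto simp: Asc_L_def Asc_R_def)

lemma dual: "two_presentations n (inv' w) J I J' I'"
proof -
  note r = index_ranges
  have inv_mem: "y \<in> double_coset n K (inv' w) L \<longleftrightarrow> bij y \<and> inv' y \<in> double_coset n L w K"
    if "K \<subseteq> {1..<n}" "L \<subseteq> {1..<n}" for y K L
  proof
    assume y: "y \<in> double_coset n K (inv' w) L"
    show "bij y \<and> inv' y \<in> double_coset n L w K"
      using double_coset_inv[OF that permutes_inv[OF w] y] permutes_inv_inv[OF w]
        double_coset_permutes[OF y that permutes_inv[OF w]] by (simp add: permutes_bij)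
  next
    assume "bij y \<and> inv' y \<in> double_coset n L w K"
    then show "y \<in> double_coset n K (inv' w) L"
      using double_coset_inv[OF that(2,1) w, of "inv' y"] by (simp add: inv_inv_eq)
  qed
  have "double_coset n J (inv' w) I = double_coset n J' (inv' w) I'"
    using same r by (auto simp: inv_mem)
  then show ?thesis
    using I J I' J' w
    by unfold_locales (simp_all add: Asc_L_inv Asc_R_inv permutes_inv)
qed

lemma inv_less: "{l..m} \<subseteq> Asc_L n w \<Longrightarrow> l \<le> m \<Longrightarrow> inv' w l < inv' w (m + 1)"
  using ascending_run[of "{l..m}" n "inv' w" l "m + 1"]
  by (simp add: Asc_R_inv[OF w] atLeastLessThanSuc_atLeastAtMost flip: Suc_eq_plus1)

lemma le_transpose_iff:
  assumes "l \<le> i" "i \<le> m"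
  shows "{k. (transpose l (m + 1) \<circ> w) k \<le> i} =
    insert (inv' w (m + 1)) ({k. w k \<le> i} - {inv' w l})"
proof -
  have "w k = c \<longleftrightarrow> k = inv' w c" for k c
    using permutes_inv_eq[OF w, of c k] by auto
  note this[symmetric, simp] permutes_inverses(1)[OF w, simp]
  show ?thesis using assms by (auto simp: transpose_def)
qed

lemma component_transfers:
  assumes sub: "{l..m} \<subseteq> I" and i: "i \<in> {l..m}" "i \<notin> I'"
  shows "{l..m} \<subseteq> small_Asc_L n w" "inv' w ` {l..m} \<subseteq> J'"
proof -
  note r = index_ranges
  define x z where "x = inv' w l" and "z = inv' w (m + 1)"
  have wx: "w x = l" "w z = m + 1" unfolding x_def z_def by (simp_all add: permutes_inverses(1)[OF w])
  have xz: "x < z" unfolding x_def z_def using sub i I by (intro inv_less) auto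
  have "transpose l (m + 1) \<in> parabolic n I"
    using sub i by (intro transpose_in_parabolic) auto
  then have yC: "transpose l (m + 1) \<circ> w \<in> double_coset n I' w J'"
    using same double_coset_left self_in_double_coset by blast
  have "block J' x = block J' z"
    using block_eq_of_exchange[OF w r(3,4) yC i(2)] i wx(1) le_transpose_iff[of l i m]
    unfolding x_def z_def by simp
  then have run: "{x..<z} \<subseteq> J'" using xz block_eq_iff[of x z J'] by simp
  have pos: "x \<le> inv' w k \<and> inv' w k < z" if "k \<in> {l..m}" for k
  proof
    have "{l..k - 1} \<subseteq> {l..m}" using that by auto
    then have "{l..k - 1} \<subseteq> Asc_L n w" using sub I by blast
    moreover have "l \<le> k - 1 \<and> k - 1 + 1 = k" if "l \<noteq> k" using that \<open>k \<in> {l..m}\<close> by auto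
    ultimately have "inv' w l < inv' w k" if "l \<noteq> k"
      using inv_less[of l "k - 1"] that by metis
    then show "x \<le> inv' w k" by (cases "k = l") (auto simp: x_def)
    show "inv' w k < z"
      unfolding z_def
    proof (rule inv_less)
      have "{k..m} \<subseteq> {l..m}" using that by auto
      then show "{k..m} \<subseteq> Asc_L n w" using sub I by blast
    qed (use that in simp)
  qed
  then show "inv' w ` {l..m} \<subseteq> J'" using run by auto
  show "{l..m} \<subseteq> small_Asc_L n w"
  proof
    fix k assume k: "k \<in> {l..m}"
    have lt: "inv' w k < inv' w (k + 1)" using sub I k by (intro inv_less) auto
    have le: "inv' w (k + 1) \<le> z"
      using pos[of "k + 1"] k by (cases "k = m") (auto simp: z_def)
    have "inv' w (k + 1) = inv' w k + 1"
    proof (rule ccontr)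
      assume "inv' w (k + 1) \<noteq> inv' w k + 1"
      then have gap: "inv' w k + 1 < inv' w (k + 1)" using lt by simp
      have "w (inv' w k) < w (inv' w k + 1)"
        using run pos[OF k] by (intro ascending_run[OF J']) auto
      moreover have "w (inv' w k + 1) < w (inv' w (k + 1))"
        using run pos[OF k] gap le by (intro ascending_run[OF J']) auto
      ultimately show False by (simp add: permutes_inverses(1)[OF w])
    qed
    moreover have "k \<in> {1..<n}" using k sub r(1) by blast
    ultimately show "k \<in> small_Asc_L n w" by (simp add: small_Asc_L_def)
  qed
qed

lemma lower_neighbour:
  assumes sub: "{m + 1..i} \<subseteq> I" "m < i" and i: "i \<notin> I'"
    and m: "m \<in> small_Asc_L n w" "inv' w m \<in> J"
  shows "inv' w m \<in> J'"
proof -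
  note r = index_ranges
  let ?y = "transpose (m + 1) (i + 1) \<circ> (simple_refl m \<circ> w)"
  have "transpose (m + 1) (i + 1) \<in> parabolic n I"
    using sub by (intro transpose_in_parabolic) auto
  then have yC: "?y \<in> double_coset n I' w J'"
    unfolding small_Asc_L_comp[OF w m(1)] same[symmetric]
    by (intro double_coset_left double_coset_right simple_refl_in_parabolic m self_in_double_coset)
  have low: "{k. ?y k \<le> i} = insert (inv' w (i + 1)) ({k. w k \<le> i} - {inv' w m})"
  proof -
    have "w k = c \<longleftrightarrow> k = inv' w c" for k c
      using permutes_inv_eq[OF w, of c k] by auto
    note this[symmetric, simp] permutes_inverses(1)[OF w, simp]
    show ?thesis using sub(2) by (auto simp: transpose_def simple_refl_def)
  qed
  have "block J' (inv' w m) = block J' (inv' w (i + 1))"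
    by (rule block_eq_of_exchange[OF w r(3,4) yC i low])
      (use sub(2) in \<open>simp add: permutes_inverses(1)[OF w]\<close>)
  moreover have lt: "inv' w m < inv' w (i + 1)"
  proof (rule inv_less)
    have "m \<in> Asc_L n w" using m by (auto simp: small_Asc_L_def Asc_L_def)
    moreover have "{m..i} = insert m {m + 1..i}" using sub(2) by auto
    ultimately show "{m..i} \<subseteq> Asc_L n w" using sub(1) I by auto
  qed (use sub in simp)
  ultimately have "{inv' w m..<inv' w (i + 1)} \<subseteq> J'"
    using block_eq_iff[of "inv' w m" "inv' w (i + 1)" J'] by simp
  then show ?thesis using lt by auto
qed

lemma upper_neighbour:
  assumes sub: "{i..b} \<subseteq> I" "i \<le> b" and i: "i \<notin> I'"
    and b: "b + 1 \<in> small_Asc_L n w" "inv' w (b + 1) \<in> J"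
  shows "inv' w (b + 1) \<in> J'"
proof -
  note r = index_ranges
  let ?y = "transpose i (b + 1) \<circ> (simple_refl (b + 1) \<circ> w)"
  have "transpose i (b + 1) \<in> parabolic n I"
    using sub by (intro transpose_in_parabolic) auto
  then have yC: "?y \<in> double_coset n I' w J'"
    unfolding small_Asc_L_comp[OF w b(1)] same[symmetric]
    by (intro double_coset_left double_coset_right simple_refl_in_parabolic b self_in_double_coset)
  have low: "{k. ?y k \<le> i} = insert (inv' w (b + 2)) ({k. w k \<le> i} - {inv' w i})"
  proof -
    have "w k = c \<longleftrightarrow> k = inv' w c" for k c
      using permutes_inv_eq[OF w, of c k] by auto
    note this[symmetric, simp] permutes_inverses(1)[OF w, simp]
    show ?thesis using sub(2) by (auto simp: transpose_def simple_refl_def)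
  qed
  have "block J' (inv' w i) = block J' (inv' w (b + 2))"
    by (rule block_eq_of_exchange[OF w r(3,4) yC i low])
      (simp add: permutes_inverses(1)[OF w])
  moreover have nxt: "inv' w (b + 2) = inv' w (b + 1) + 1"
    using b by (simp add: small_Asc_L_def add.assoc)
  moreover have lt: "inv' w i < inv' w (b + 1)"
    using sub I by (intro inv_less) auto
  ultimately have "{inv' w i..<inv' w (b + 1) + 1} \<subseteq> J'"
    using block_eq_iff[of "inv' w i" "inv' w (b + 1) + 1" J'] by simp
  then show ?thesis using lt by auto
qed

end

lemma component_exists:
  fixes I :: "nat set"
  assumes I: "I \<subseteq> {1..<n}" and i: "i \<in> I"
  obtains a b where "1 \<le> a" "a \<le> i" "i \<le> b" "b \<le> n - 1" "{a - 1..b + 1} \<inter> I = {a..b}"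
proof -
  define a where "a = (LEAST a. {a..i} \<subseteq> I)"
  define b where "b = (GREATEST b. {i..b} \<subseteq> I)"
  have base: "{i..i} \<subseteq> I" using i by simp
  have a: "{a..i} \<subseteq> I" "a \<le> i"
    unfolding a_def using LeastI[of "\<lambda>a. {a..i} \<subseteq> I", OF base]
      Least_le[of "\<lambda>a. {a..i} \<subseteq> I", OF base] by auto
  have bound: "b \<le> n" if "{i..b} \<subseteq> I" for b
    using that I i by (cases "i \<le> b") force+
  have b: "{i..b} \<subseteq> I" "i \<le> b"
    unfolding b_def using GreatestI_nat[of "\<lambda>b. {i..b} \<subseteq> I", OF base bound]
      Greatest_le_nat[of "\<lambda>b. {i..b} \<subseteq> I", OF base bound] by auto
  have a1: "1 \<le> a" and bn: "b < n" using a b I by (force simp: subset_iff)+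
  have "a - 1 \<notin> I"
  proof
    assume "a - 1 \<in> I"
    moreover have "{a - 1..i} = insert (a - 1) {a..i}" using a1 a(2) by auto
    ultimately have "{a - 1..i} \<subseteq> I" using a by auto
    then have "a \<le> a - 1" unfolding a_def by (rule Least_le)
    then show False using a1 by simp
  qed
  moreover have "b + 1 \<notin> I"
  proof
    assume "b + 1 \<in> I"
    moreover have "{i..b + 1} = insert (b + 1) {i..b}" using b(2) by auto
    ultimately have "{i..b + 1} \<subseteq> I" using b by auto
    then have "b + 1 \<le> b" unfolding b_def using bound by (rule Greatest_le_nat)
    then show False by simp
  qed
  moreover have "{a..b} = {a..i} \<union> {i..b}" using a b by auto
  then have "{a..b} \<subseteq> I" using a b by auto
  moreover have "{a - 1..b + 1} = insert (a - 1) (insert (b + 1) {a..b})"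
    using a1 a b by auto
  ultimately have "{a - 1..b + 1} \<inter> I = {a..b}" by auto
  then show thesis using that[of a b] a b a1 bn by simp
qed


theorem theorem3p9:
  fixes n :: nat and w :: "nat \<Rightarrow> nat" and I J :: "nat set"
  assumes "w \<in> carrier (sym_group n)"
    and "I \<subseteq> Asc_L n w"
    and "J \<subseteq> Asc_R n w"
  shows "(\<exists>C. parabolic_double_coset n C \<and> lex_minimal_presentation n C I w J) \<longleftrightarrow>
    (\<forall>a b. 1 \<le> a \<and> a \<le> b \<and> b \<le> n - 1 \<and>
        {a - 1..b + 1} \<inter> I = {a..b} \<and> {a..b} \<subseteq> small_Asc_L n w \<longrightarrow>
        \<not> inv' w ` {a..b} \<subseteq> J \<and>
        ({inv' w a - 1} \<union> inv' w ` {a..b} \<union> {inv' w b + 1}) \<inter> J \<noteq> {}) \<and>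
    (\<forall>a b. 1 \<le> a \<and> a \<le> b \<and> b \<le> n - 1 \<and>
        {a - 1..b + 1} \<inter> J = {a..b} \<and> {a..b} \<subseteq> small_Asc_R n w \<longrightarrow>
        \<not> w ` {a..b} \<subseteq> I)"
    (is "?lexmin \<longleftrightarrow> ?left \<and> ?right")
proof -
  have w: "w permutes {1..n}" using assms(1) by (simp add: sym_group_carrier)
  note w_inv = permutes_inverses(1)[OF w] and inv_w = permutes_inverses(2)[OF w]
  have In: "I \<subseteq> {1..<n}" and Jn: "J \<subseteq> {1..<n}"
    using assms(2,3) by (auto simp: Asc_L_def Asc_R_def)
  have finI: "finite I" and finJ: "finite J" using In Jn by (auto intro: finite_subset)
  let ?C = "double_coset n I w J"
  have pres: "is_presentation n ?C I w J"
    using In Jn assms(1) by (simp add: is_presentation_def)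
  have gap: "i \<noteq> k + 1 \<and> k \<noteq> i + 1"
    if K: "{a - 1..b + 1} \<inter> K = {a..b}" "1 \<le> a" and "k \<in> {a..b}" "i \<in> K - {a..b}"
    for K :: "nat set" and a b i k
  proof -
    have "i \<notin> {a - 1..b + 1}" using that by blast
    then have "i + 1 < a \<or> b + 1 < i" using that(2) unfolding atLeastAtMost_iff by arith
    then show ?thesis using that(3) by auto
  qed
  show ?thesis
  proof
    assume ?lexmin
    then have min: "card I < card K \<or> card I = card K \<and> card J \<le> card L"
      if "K \<subseteq> {1..<n}" "L \<subseteq> {1..<n}" "double_coset n K w L = ?C" for K L
      using that assms(1) unfolding lex_minimal_presentation_def is_presentation_def by metis
    show "?left \<and> ?right"
    proof (intro conjI allI impI; elim conjE)
      fix a b assume ab: "1 \<le> a" "a \<le> b" "b \<le> n - 1" "{a - 1..b + 1} \<inter> I = {a..b}"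
        "{a..b} \<subseteq> small_Asc_L n w"
      let ?A = "{a..b}"
      let ?P = "inv' w ` ?A"
      have AI: "?A \<subseteq> I" using ab(4) by blast
      have P: "?P \<subseteq> {1..<n}" using small_Asc_L_range[OF w] ab(5) by blast
      have movable: False
        if "?P \<subseteq> J \<or> (\<forall>p\<in>?P. \<forall>j\<in>J. j \<noteq> p + 1 \<and> p \<noteq> j + 1)"
      proof -
        have "double_coset n (I - ?A \<union> ?A) w J = double_coset n (I - ?A) w (J \<union> ?P)"
          using In that gap[OF ab(4,1)] by (intro double_coset_move[OF w _ Jn ab(5)]) blast+
        moreover have "I - ?A \<union> ?A = I" using AI by auto
        ultimately have "card I \<le> card (I - ?A)"
          using min[of "I - ?A" "J \<union> ?P"] subset_trans[OF Diff_subset In, of ?A] Jn P by auto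
        moreover have "card (I - ?A) < card I"
        proof (rule psubset_card_mono[OF finI])
          have "a \<in> ?A" using ab(2) by simp
          then show "I - ?A \<subset> I" using AI by blast
        qed
        ultimately show False by simp
      qed
      then show "\<not> ?P \<subseteq> J" by blast
      show "({inv' w a - 1} \<union> ?P \<union> {inv' w b + 1}) \<inter> J \<noteq> {}"
      proof
        assume disj: "({inv' w a - 1} \<union> ?P \<union> {inv' w b + 1}) \<inter> J = {}"
        have step: "inv' w (k + 1) = inv' w k + 1" if "k \<in> ?A" for k
          using ab(5) that by (auto simp: small_Asc_L_def)
        have "j \<noteq> inv' w k + 1 \<and> inv' w k \<noteq> j + 1" if "k \<in> ?A" "j \<in> J" for k j
        proof
          show "j \<noteq> inv' w k + 1"
          proof
            assume j: "j = inv' w k + 1"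
            then have "k \<noteq> b" using disj that(2) by auto
            then have "inv' w (k + 1) \<in> ?P" using that(1) by auto
            then show False using disj that j step[of k] by auto
          qed
          show "inv' w k \<noteq> j + 1"
          proof
            assume j: "inv' w k = j + 1"
            then have "k \<noteq> a" using disj that(2) by auto
            then have "k - 1 \<in> ?A" "k - 1 + 1 = k" using that(1) by auto
            then have "j = inv' w (k - 1)" using step[of "k - 1"] j by simp
            then show False using disj that(2) \<open>k - 1 \<in> ?A\<close> by blast
          qed
        qed
        then have "\<forall>p\<in>?P. \<forall>j\<in>J. j \<noteq> p + 1 \<and> p \<noteq> j + 1" by (intro ballI) (elim imageE, simp)
        then show False by (intro movable disjI2)
      qed
    next
      fix a b assume ab: "1 \<le> a" "a \<le> b" "b \<le> n - 1" "{a - 1..b + 1} \<inter> J = {a..b}"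
        "{a..b} \<subseteq> small_Asc_R n w"
      let ?B = "{a..b}"
      have BJ: "?B \<subseteq> J" using ab(4) by blast
      have inv_image: "inv' w ` w ` ?B = ?B" by (simp add: image_comp inv_w)
      have small: "w ` ?B \<subseteq> small_Asc_L n w"
      proof
        fix i assume "i \<in> w ` ?B"
        then obtain k where k: "k \<in> small_Asc_R n w" "i = w k" using ab(5) by auto
        then have "w (k + 1) = i + 1" "k \<in> {1..<n}" by (auto simp: small_Asc_R_def)
        moreover have "i \<in> {1..n}" "w (k + 1) \<in> {1..n}"
          using k(2) calculation(2) permutes_in_image[OF w] by simp_all
        ultimately show "i \<in> small_Asc_L n w"
          using inv_w[of k] inv_w[of "k + 1"] k(2) by (auto simp: small_Asc_L_def)
      qed
      show "\<not> w ` ?B \<subseteq> I"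
      proof
        assume WI: "w ` ?B \<subseteq> I"
        have "double_coset n (I \<union> w ` ?B) w (J - ?B) =
            double_coset n I w (J - ?B \<union> inv' w ` w ` ?B)"
          using Jn WI gap[OF ab(4,1)] unfolding inv_image
          by (intro double_coset_move[OF w In _ small, unfolded inv_image]) blast+
        moreover have "I \<union> w ` ?B = I" "J - ?B \<union> ?B = J" using WI BJ by auto
        ultimately have "card J \<le> card (J - ?B)"
          using min[of I "J - ?B"] In subset_trans[OF Diff_subset Jn, of ?B] unfolding inv_image by auto
        moreover have "card (J - ?B) < card J"
        proof (rule psubset_card_mono[OF finJ])
          have "a \<in> ?B" using ab(2) by simp
          then show "J - ?B \<subset> J" using BJ by blast
        qed
        ultimately show False by simp
      qed
    qed
  next
    assume "?left \<and> ?right"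
    then have left: "\<And>a b. 1 \<le> a \<Longrightarrow> a \<le> b \<Longrightarrow> b \<le> n - 1 \<Longrightarrow> {a - 1..b + 1} \<inter> I = {a..b} \<Longrightarrow>
          {a..b} \<subseteq> small_Asc_L n w \<Longrightarrow> \<not> inv' w ` {a..b} \<subseteq> J \<and>
          ({inv' w a - 1} \<union> inv' w ` {a..b} \<union> {inv' w b + 1}) \<inter> J \<noteq> {}"
      and right: "\<And>a b. 1 \<le> a \<Longrightarrow> a \<le> b \<Longrightarrow> b \<le> n - 1 \<Longrightarrow> {a - 1..b + 1} \<inter> J = {a..b} \<Longrightarrow>
          {a..b} \<subseteq> small_Asc_R n w \<Longrightarrow> \<not> w ` {a..b} \<subseteq> I"
      by blast+
    have least: "bruhat_least n ?C w" by (rule bruhat_least_double_coset[OF w assms(2,3)])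
    have "card I < card I' \<or> card I = card I' \<and> card J \<le> card J'"
      if "is_presentation n ?C I' x' J'" for I' x' J'
    proof -
      have I'n: "I' \<subseteq> {1..<n}" and J'n: "J' \<subseteq> {1..<n}" and x': "x' permutes {1..n}"
        and C': "?C = double_coset n I' x' J'"
        using that by (simp_all add: is_presentation_def sym_group_carrier)
      have "w \<in> double_coset n I' x' J'"
        using self_in_double_coset[of w n I J] C' by simp
      then have same: "?C = double_coset n I' w J'"
        using C' double_coset_rebase[OF I'n J'n x'] by simp
      then have asc': "I' \<subseteq> Asc_L n w" "J' \<subseteq> Asc_R n w"
        using bruhat_least_Asc[OF w I'n J'n] least by simp_all
      interpret P: two_presentations n w I J I' J'
        by unfold_locales (use w assms(2,3) asc' same in simp_all)
      interpret S: two_presentations n w I' J' I J by (rule P.swap)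
      interpret D: two_presentations n "inv' w" J I J' I' by (rule P.dual)
      interpret SD: two_presentations n "inv' w" J' I' J I by (rule S.dual)
      note dual_simps = small_Asc_L_inv[OF w] permutes_inv_inv[OF w]
      have D_transfers: "{l..m} \<subseteq> small_Asc_R n w" "w ` {l..m} \<subseteq> I'"
        if "{l..m} \<subseteq> J" "j \<in> {l..m}" "j \<notin> J'" for l m j
        using D.component_transfers[OF that] by (simp_all add: dual_simps)
      have SD_transfers: "{l..m} \<subseteq> small_Asc_R n w" "w ` {l..m} \<subseteq> I"
        if "{l..m} \<subseteq> J'" "j \<in> {l..m}" "j \<notin> J" for l m j
        using SD.component_transfers[OF that] by (simp_all add: dual_simps)
      have "I \<subseteq> I'"
      proof (rule ccontr)
        assume "\<not> I \<subseteq> I'"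
        then obtain i where i: "i \<in> I" "i \<notin> I'" by blast
        obtain a b where ab: "1 \<le> a" "a \<le> i" "i \<le> b" "b \<le> n - 1" "{a - 1..b + 1} \<inter> I = {a..b}"
          by (rule component_exists[OF In i(1)])
        let ?A = "{a..b}"
        let ?P = "inv' w ` ?A"
        have AI: "?A \<subseteq> I" and aI: "a - 1 \<notin> I" and bI: "b + 1 \<notin> I"
        proof -
          show "?A \<subseteq> I" using ab(5) by blast
          have "a - 1 \<notin> ?A" "b + 1 \<notin> ?A" "a - 1 \<in> {a - 1..b + 1}" "b + 1 \<in> {a - 1..b + 1}"
            using ab by auto
          then show "a - 1 \<notin> I" "b + 1 \<notin> I" using ab(5) by blast+
        qed
        have small: "?A \<subseteq> small_Asc_L n w" and PJ': "?P \<subseteq> J'"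
          using P.component_transfers[OF AI _ i(2)] ab by auto
        have P_eq: "inv' w (a + d) = inv' w a + d" if "a + d \<le> b + 1" for d
          using that
        proof (induction d)
          case (Suc d)
          then have "a + d \<in> small_Asc_L n w" using small by auto
          then show ?case using Suc by (simp add: small_Asc_L_def Suc_eq_plus1 add.assoc)
        qed simp
        define p q where "p = inv' w a" and "q = inv' w b"
        have q: "q = p + (b - a)" using P_eq[of "b - a"] ab by (simp add: p_def q_def)
        have P: "?P = {p..q}"
        proof (intro equalityI subsetI)
          fix k assume "k \<in> ?P"
          then obtain c where "c \<in> ?A" "k = inv' w c" by auto
          then have "k = p + (c - a)" "c \<le> b" using P_eq[of "c - a"] by (auto simp: p_def)
          then show "k \<in> {p..q}" using q by (simp only: atLeastAtMost_iff) arith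
        next
          fix k assume k: "k \<in> {p..q}"
          then have "k = inv' w (a + (k - p))" "a + (k - p) \<in> ?A"
            using P_eq[of "k - p"] q ab by (auto simp: p_def)
          then show "k \<in> ?P" by (rule image_eqI)
        qed
        have wp: "w p = a" and wq: "w q = b" by (simp_all add: p_def q_def w_inv)
        have "a + (b + 1 - a) = b + 1" and "inv' w a + (b + 1 - a) = q + 1"
          using ab q unfolding p_def by arith+
        then have "inv' w (b + 1) = q + 1" using P_eq[of "b + 1 - a"] by simp
        then have wq1: "w (q + 1) = b + 1" using w_inv[of "b + 1"] by simp
        have pn: "p \<in> {1..<n}" and qn: "q \<in> {1..<n}"
        proof -
          have "a \<in> ?A" "b \<in> ?A" using ab by simp_all
          then show "p \<in> {1..<n}" "q \<in> {1..<n}"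
            using small_Asc_L_range[OF w] small unfolding p_def q_def by blast+
        qed
        have "a \<le> b" using ab by simp
        note left_ab = left[OF ab(1) this ab(4,5) small, folded p_def q_def, unfolded P]
        then obtain r where r: "r \<in> {p..q}" "r \<notin> J" by blast
        have pJ': "p - 1 \<notin> J'"
        proof
          assume "p - 1 \<in> J'"
          moreover have "{p - 1..r} \<subseteq> insert (p - 1) {p..q}" using r pn by auto
          ultimately have "{p - 1..r} \<subseteq> J'" using PJ' P by blast
          moreover have "r \<in> {p - 1..r}" "p - 1 \<in> {p - 1..r}" using r by auto
          ultimately have "p - 1 \<in> small_Asc_R n w" "w (p - 1) \<in> I"
            using SD_transfers[of "p - 1" r r] r(2) by blast+
          then show False using wp aI pn by (simp add: small_Asc_R_def flip: wp)
        qed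
        have qJ': "q + 1 \<notin> J'"
        proof
          assume "q + 1 \<in> J'"
          moreover have "{r..q + 1} \<subseteq> insert (q + 1) {p..q}" using r by auto
          ultimately have "{r..q + 1} \<subseteq> J'" using PJ' P by blast
          moreover have "r \<in> {r..q + 1}" "q + 1 \<in> {r..q + 1}" using r by auto
          ultimately have "w (q + 1) \<in> I"
            using SD_transfers(2)[of r "q + 1" r] r(2) by blast
          then show False using wq1 bI by simp
        qed
        have pJ: "p - 1 \<notin> J"
        proof
          assume pJ: "p - 1 \<in> J"
          then have "p - 1 \<in> small_Asc_R n w"
            using D_transfers(1)[of "p - 1" "p - 1" "p - 1"] pJ' by simp
          then have wp1: "w (p - 1) + 1 = a" using wp pn by (auto simp: small_Asc_R_def)
          define m where "m = w (p - 1)"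
          have am: "a = m + 1" using wp1 by (simp add: m_def)
          have inv_m: "inv' w m = p - 1" by (simp add: m_def inv_w)
          have "p - 1 \<in> {1..n}" using pJ Jn by auto
          then have "m \<in> {1..n}" using permutes_in_image[OF w] by (simp add: m_def)
          then have "m \<in> small_Asc_L n w"
            using inv_m am ab pn by (auto simp: small_Asc_L_def p_def)
          moreover have "{m + 1..i} \<subseteq> ?A" using am ab by auto
          then have "{m + 1..i} \<subseteq> I" using AI by blast
          ultimately have "inv' w m \<in> J'"
            using ab i(2) pJ inv_m am by (intro P.lower_neighbour[of m i]) auto
          then show False using inv_m pJ' by simp
        qed
        have qJ: "q + 1 \<notin> J"
        proof
          assume qJ: "q + 1 \<in> J"
          then have "q + 1 \<in> small_Asc_R n w"
            using D_transfers(1)[of "q + 1" "q + 1" "q + 1"] qJ' by simp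
          then have wq2: "w (q + 2) = b + 2" and "q + 2 \<le> n"
            using wq1 by (auto simp: small_Asc_R_def add.assoc)
          then have "b + 2 \<in> {1..n}" using permutes_in_image[OF w, of "q + 2"] by simp
          moreover have "inv' w (b + 1) = q + 1" "inv' w (b + 2) = q + 2"
            using inv_w[of "q + 1"] inv_w[of "q + 2"] wq1 wq2 by simp_all
          ultimately have "b + 1 \<in> small_Asc_L n w" by (auto simp: small_Asc_L_def add.assoc)
          moreover have "{i..b} \<subseteq> ?A" using ab by auto
          then have "{i..b} \<subseteq> I" using AI by blast
          ultimately have "inv' w (b + 1) \<in> J'"
            using ab i(2) qJ \<open>inv' w (b + 1) = q + 1\<close>
            by (intro P.upper_neighbour[of i b]) auto
          then show False using \<open>inv' w (b + 1) = q + 1\<close> qJ' by simp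
        qed
        obtain j where j: "j \<in> {p..q}" "j \<in> J"
          using left_ab pJ qJ by blast
        obtain c d where cd: "1 \<le> c" "c \<le> j" "j \<le> d" "d \<le> n - 1" "{c - 1..d + 1} \<inter> J = {c..d}"
          by (rule component_exists[OF Jn j(2)])
        have cdJ: "{c..d} \<subseteq> J" using cd(5) by blast
        have "p \<le> c"
        proof (rule ccontr)
          assume "\<not> p \<le> c"
          then have "p - 1 \<in> {c..d}" using j cd by auto
          then show False using cdJ pJ by blast
        qed
        moreover have "d \<le> q"
        proof (rule ccontr)
          assume "\<not> d \<le> q"
          then have "q + 1 \<in> {c..d}" using j cd by auto
          then show False using cdJ qJ by blast
        qed
        ultimately have sub: "{c..d} \<subseteq> ?P" unfolding P by auto
        have "k \<in> small_Asc_R n w \<and> w k \<in> I" if "k \<in> {c..d}" for k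
        proof -
          obtain e where e: "e \<in> ?A" "k = inv' w e" using sub \<open>k \<in> {c..d}\<close> by blast
          then have "w k = e" "w (k + 1) = e + 1" "k \<in> {1..<n}"
            using small w_inv[of e] w_inv[of "e + 1"] small_Asc_L_range[OF w, of e]
            by (auto simp: small_Asc_L_def subset_iff)
          then show ?thesis using AI e(1) by (auto simp: small_Asc_R_def)
        qed
        then show False using right[OF cd(1) _ cd(4,5)] cd by force
      qed
      moreover have "J \<subseteq> J'" if eq: "I = I'"
      proof (rule ccontr)
        assume "\<not> J \<subseteq> J'"
        then obtain j where j: "j \<in> J" "j \<notin> J'" by blast
        obtain c d where cd: "1 \<le> c" "c \<le> j" "j \<le> d" "d \<le> n - 1" "{c - 1..d + 1} \<inter> J = {c..d}"
          by (rule component_exists[OF Jn j(1)])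
        have "{c..d} \<subseteq> J" using cd(5) by blast
        then show False
          using D_transfers[of c d j] j cd eq right[of c d] by simp
      qed
      moreover have "finite I'" "finite J'" using I'n J'n by (auto intro: finite_subset)
      ultimately show ?thesis
        by (metis card_mono card_subset_eq le_neq_implies_less)
    qed
    then have "lex_minimal_presentation n ?C I w J"
      using pres least unfolding lex_minimal_presentation_def by blast
    moreover have "parabolic_double_coset n ?C"
      using pres unfolding parabolic_double_coset_def by blast
    ultimately show ?lexmin by blast
  qed
qed

end
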